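(* Let $(\mathbf X_m,\mathbf y_m)$, $m=1,\dots,T$, with $\mathbf X_m\in\mathbb R^{n_m\times d}$, $\mathbf y_m\in\mathbb R^{n_m}$, be jointly realizable regression tasks, let $\mathbf w_\star$ be the minimum-norm joint solution and $R=\max_{m}\|\mathbf X_m\|$. Let $\tau$ be a random task ordering with replacement and let $\mathbf w_0,\dots,\mathbf w_k$ be the iterates of continual linear regression learned to convergence (equivalently, of the block Kaczmarz method). Then for every $k\ge2$, $$\mathbb E_\tau[\mathcal L(\mathbf w_k)]\le\frac{2\|\mathbf w_\star\|^2R^2}{\sqrt[4]{k}},\qquad \mathbb E_\tau[F_\tau(k)]\le\frac{5\|\mathbf w_\star\|^2R^2}{\sqrt[4]{k-1}}.$$
   Context: Notation: $\|\cdot\|$ is the Euclidean norm for vectors and the spectral norm for matrices; $\mathbf X^+$ is the Moore--Penrose pseudo-inverse. Joint realizability: the set $\mathcal W_\star=\{\mathbf w\in\mathbb R^d:\mathbf X_m\mathbf w=\mathbf y_m\ \forall m\in\{1,\dots,T\}\}$ is nonempty. $\mathbf w_\star=\operatorname{argmin}_{\mathbf w\in\mathcal W_\star}\|\mathbf w\|$. Random task ordering with replacement: $\tau(1),\dots,\tau(k)$ are i.i.d. uniform on $\{1,\dots,T\}$. Iterates: $\mathbf w_0=\mathbf 0$; at iteration $t$ the learner starts from $\mathbf w_{t-1}$ and minimizes the loss $\mathcal L_{\tau(t)}(\mathbf w)=\frac12\|\mathbf X_{\tau(t)}\mathbf w-\mathbf y_{\tau(t)}\|^2$ by gradient descent to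 convergence, yielding $\mathbf w_t$. Explicitly (block Kaczmarz update), $\mathbf w_t=\mathbf w_{t-1}-\mathbf X_{\tau(t)}^+(\mathbf X_{\tau(t)}\mathbf w_{t-1}-\mathbf y_{\tau(t)})$. Training loss: $\mathcal L(\mathbf w)=\frac1{2T}\sum_{m=1}^T\|\mathbf X_m\mathbf w-\mathbf y_m\|^2$. Forgetting: $F_\tau(k)=\frac1{2k}\sum_{t=1}^k\|\mathbf X_{\tau(t)}\mathbf w_k-\mathbf y_{\tau(t)}\|^2$. *)

theory Defs
  imports "HOL-Probability.Product_PMF" "Jordan_Normal_Form.Matrix"
begin

hide_type (open) Finite_Cartesian_Product.vec
hide_const (open) Finite_Cartesian_Product.vec Finite_Cartesian_Product.mat

no_notation Finite_Cartesian_Product.vec_nth (infixl \<open>$\<close> 90)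
no_notation Inner_Product.real_inner_class.inner (infix \<open>\<bullet>\<close> 70)

definition eucl_norm :: "real vec \<Rightarrow> real" where
  "eucl_norm v = sqrt (v \<bullet> v)"

definition spectral_norm :: "real mat \<Rightarrow> real" where
  "spectral_norm A = (SUP v \<in> {v \<in> carrier_vec (dim_col A). eucl_norm v \<le> 1}. eucl_norm (A *\<^sub>v v))"

definition is_pseudo_inverse :: "real mat \<Rightarrow> real mat \<Rightarrow> bool" where
  "is_pseudo_inverse A B \<longleftrightarrow>
     B \<in> carrier_mat (dim_col A) (dim_row A) \<and>
     A * B * A = A \<and> B * A * B = B \<and>
     transpose_mat (A * B) = A * B \<and> transpose_mat (B * A) = B * A"

(* Every real matrix has exactly one Moore-Penrose pseudo-inverse. *)
definition pseudo_inverse :: "real mat \<Rightarrow> real mat" where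
  "pseudo_inverse A = (THE B. is_pseudo_inverse A B)"

definition joint_solutions ::
  "nat \<Rightarrow> nat \<Rightarrow> (nat \<Rightarrow> real mat) \<Rightarrow> (nat \<Rightarrow> real vec) \<Rightarrow> real vec set" where
  "joint_solutions d T X y = {w \<in> carrier_vec d. \<forall>m\<in>{1..T}. X m *\<^sub>v w = y m}"

(* The minimizer is unique: the set of joint solutions is an affine subspace. *)
definition min_norm_solution ::
  "nat \<Rightarrow> nat \<Rightarrow> (nat \<Rightarrow> real mat) \<Rightarrow> (nat \<Rightarrow> real vec) \<Rightarrow> real vec" where
  "min_norm_solution d T X y = (ARG_MIN eucl_norm w. w \<in> joint_solutions d T X y)"

(* Gradient descent from w on (1/2) * ||X m w - y m||^2 converges to
   w - X m^+ (X m w - y m), so learning each task to convergence is the block Kaczmarz update. *)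
primrec iterate ::
  "nat \<Rightarrow> (nat \<Rightarrow> real mat) \<Rightarrow> (nat \<Rightarrow> real vec) \<Rightarrow> (nat \<Rightarrow> nat) \<Rightarrow> nat \<Rightarrow> real vec" where
  "iterate d X y \<tau> 0 = 0\<^sub>v d"
| "iterate d X y \<tau> (Suc t) =
     (let m = \<tau> (Suc t); w = iterate d X y \<tau> t
      in w - pseudo_inverse (X m) *\<^sub>v (X m *\<^sub>v w - y m))"

definition training_loss ::
  "nat \<Rightarrow> (nat \<Rightarrow> real mat) \<Rightarrow> (nat \<Rightarrow> real vec) \<Rightarrow> real vec \<Rightarrow> real" where
  "training_loss T X y w = 1 / (2 * real T) * (\<Sum>m=1..T. (eucl_norm (X m *\<^sub>v w - y m))\<^sup>2)"

definition forgetting ::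
  "nat \<Rightarrow> (nat \<Rightarrow> real mat) \<Rightarrow> (nat \<Rightarrow> real vec) \<Rightarrow> (nat \<Rightarrow> nat) \<Rightarrow> nat \<Rightarrow> real" where
  "forgetting d X y \<tau> k =
     1 / (2 * real k) * (\<Sum>t=1..k. (eucl_norm (X (\<tau> t) *\<^sub>v iterate d X y \<tau> k - y (\<tau> t)))\<^sup>2)"

(* Orderings are functions on all of nat; they take the dummy value 0 outside {1..k}. *)
definition random_ordering :: "nat \<Rightarrow> nat \<Rightarrow> (nat \<Rightarrow> nat) pmf" where
  "random_ordering T k = Pi_pmf {1..k} 0 (\<lambda>_. pmf_of_set {1..T})"

end

theory Submission
  imports Defs
begin

text \<open>
  The error \<open>z\<^sub>t = w\<^sub>t - w\<^sub>\<star>\<close> evolves by \<open>z\<^sub>t = z\<^sub>t\<^sub>-\<^sub>1 - Q z\<^sub>t\<^sub>-\<^sub>1\<close>, where \<open>Q = X\<^sup>+ X\<close> is the orthogonal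
  projection of a uniformly random task. Put \<open>e\<^sub>t = E \<parallel>z\<^sub>t\<parallel>\<^sup>2\<close> and \<open>a\<^sub>t = E \<parallel>Q z\<^sub>t\<parallel>\<^sup>2\<close> with \<open>Q\<close> independent of
  \<open>z\<^sub>t\<close>; by Pythagoras \<open>a\<^sub>t = e\<^sub>t - e\<^sub>t\<^sub>+\<^sub>1\<close>. Comparing later iterates with \<open>z\<^sub>s\<close> gives
  \<open>e\<^sub>s - e\<^sub>s\<^sub>+\<^sub>j \<le> 4 j a\<^sub>s\<close>. Hence \<open>S\<^sub>s = e\<^sub>s - e\<^sub>k\<^sub>+\<^sub>1\<close> satisfies \<open>S\<^sub>s\<^sub>+\<^sub>1 \<le> (1 - 1 / (4 n)) S\<^sub>s\<close> for
  \<open>n = k + 1 - s\<close>, and multiplying these up, with \<open>(1 - 1 / (4 n))\<^sup>4 \<le> n / (n + 1)\<close>, yields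
  \<open>a\<^sub>k\<^sup>4 \<le> 2 e\<^sub>0\<^sup>4 / (k + 2)\<close>. The expected training loss is at most \<open>R\<^sup>2 a\<^sub>k / 2\<close>. For the forgetting, omitting
  step \<open>t\<close> makes the iterate independent of \<open>\<tau> t\<close> and moves it by at most \<open>\<parallel>Q z\<^sub>t\<^sub>-\<^sub>1\<parallel>\<close>, so that
  \<open>E \<parallel>Q\<^sub>\<tau>\<^sub>t z\<^sub>k\<parallel>\<^sup>2 \<le> 2 a\<^sub>k\<^sub>-\<^sub>1 + 2 a\<^sub>t\<^sub>-\<^sub>1\<close>, and the last terms sum to at most \<open>2 e\<^sub>0\<close>.
\<close>

section \<open>Pseudo-inverses, spectral norm and minimum-norm solutions\<close>

lemma scalar_prod_self_nonneg: "0 \<le> v \<bullet> (v :: real vec)"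
  by (simp add: scalar_prod_def sum_nonneg)

lemma eucl_norm_square: "(eucl_norm v)\<^sup>2 = v \<bullet> v"
  by (simp add: eucl_norm_def scalar_prod_self_nonneg)

lemma scalar_prod_self_eq_0D:
  assumes "v \<in> carrier_vec n" "v \<bullet> v = (0 :: real)"
  shows "v = 0\<^sub>v n"
proof (rule eq_vecI)
  fix i assume "i < dim_vec (0\<^sub>v n :: real vec)"
  moreover have "\<forall>i\<in>{0..<dim_vec v}. v $ i * v $ i = 0"
    using assms(2) unfolding scalar_prod_def by (subst (asm) sum_nonneg_eq_0_iff) auto
  ultimately show "v $ i = 0\<^sub>v n $ i" using assms(1) by auto
qed (use assms(1) in auto)

text \<open>The second conclusion says that \<open>p\<close> lies in the double orthogonal complement of \<open>V\<close>, that is, in its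
  span; it carries the Gram--Schmidt induction without mentioning coefficients.\<close>
lemma orthogonal_projection_exists:
  fixes W :: "real vec set"
  assumes "finite V" "V \<subseteq> W" and W: "W \<subseteq> carrier_vec n" "0\<^sub>v n \<in> W"
    and closed: "\<And>x y c. x \<in> W \<Longrightarrow> y \<in> W \<Longrightarrow> x + c \<cdot>\<^sub>v y \<in> W"
    and "b \<in> carrier_vec n"
  shows "\<exists>p\<in>W. (\<forall>v\<in>V. v \<bullet> (b - p) = 0) \<and>
           (\<forall>u\<in>carrier_vec n. (\<forall>v\<in>V. v \<bullet> u = 0) \<longrightarrow> u \<bullet> p = 0)"
  using assms(1,2,6)
proof (induction V arbitrary: b rule: finite_induct)
  case empty
  then show ?case by (intro bexI[OF _ W(2)]) auto
next
  case (insert v V)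
  have v: "v \<in> W" "v \<in> carrier_vec n" and V: "V \<subseteq> W" "V \<subseteq> carrier_vec n"
    and b: "b \<in> carrier_vec n"
    using insert.prems W by auto
  obtain q where q: "q \<in> W" "\<And>x. x \<in> V \<Longrightarrow> x \<bullet> (v - q) = 0"
      "\<And>u. u \<in> carrier_vec n \<Longrightarrow> (\<And>x. x \<in> V \<Longrightarrow> x \<bullet> u = 0) \<Longrightarrow> u \<bullet> q = 0"
    using insert.IH[OF V(1) v(2)] by blast
  obtain p where p: "p \<in> W" "\<And>x. x \<in> V \<Longrightarrow> x \<bullet> (b - p) = 0"
      "\<And>u. u \<in> carrier_vec n \<Longrightarrow> (\<And>x. x \<in> V \<Longrightarrow> x \<bullet> u = 0) \<Longrightarrow> u \<bullet> p = 0"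
    using insert.IH[OF V(1) b] by blast
  have qc: "q \<in> carrier_vec n" and pc: "p \<in> carrier_vec n" using p q W by auto
  define v' where "v' = v - q"
  have v': "v' \<in> carrier_vec n" and v_eq: "v = v' + q" using v qc by (auto simp: v'_def)
  have "v' = v + (-1) \<cdot>\<^sub>v q" using v qc by (auto simp: v'_def)
  then have v'W: "v' \<in> W" using closed v q by auto
  define r where "r = b - p"
  have r: "r \<in> carrier_vec n" using b pc by (auto simp: r_def)
  have v'q: "v' \<bullet> q = 0" using q(2,3) v' by (auto simp: v'_def)
  have rq: "r \<bullet> q = 0" using q(3) r p(2) by (auto simp: r_def)
  have qr: "q \<bullet> r = 0" and qv': "q \<bullet> v' = 0"
    using rq v'q comm_scalar_prod[OF qc r] comm_scalar_prod[OF qc v'] by auto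
  \<comment> \<open>The coefficient of the new Gram--Schmidt direction. If \<open>v'\<close> has
    norm zero then \<open>v\<close> lies already in the span of \<open>V\<close>, and the default 0
    keeps the identity for \<open>c\<close> true because \<open>v'\<close> is the zero
    vector.\<close>
  define c where "c = (if v' \<bullet> v' = 0 then 0 else (v' \<bullet> r) / (v' \<bullet> v'))"
  have c: "v' \<bullet> r = c * (v' \<bullet> v')"
    using scalar_prod_self_eq_0D[OF v'] r by (auto simp: c_def)
  define p' where "p' = p + c \<cdot>\<^sub>v v'"
  have bp': "b - p' = r - c \<cdot>\<^sub>v v'"
    using b pc v' by (auto simp: p'_def r_def)
  have ip: "x \<bullet> (b - p') = x \<bullet> r - c * (x \<bullet> v')" if "x \<in> carrier_vec n" for x
    unfolding bp' using that r v' by (simp add: scalar_prod_minus_distrib[of _ n])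
  have "v \<bullet> (b - p') = 0"
    unfolding ip[OF v(2)] unfolding v_eq
    using v' qc r qr qv' c by (simp add: add_scalar_prod_distrib[of _ n])
  moreover have "x \<bullet> (b - p') = 0" if "x \<in> V" for x
    using ip[of x] that V p(2)[OF that] q(2)[OF that] by (auto simp: r_def v'_def)
  moreover have "u \<bullet> p' = 0" if u: "u \<in> carrier_vec n" "\<And>x. x \<in> insert v V \<Longrightarrow> x \<bullet> u = 0" for u
  proof -
    have "u \<bullet> v = 0" using u comm_scalar_prod[OF u(1) v(2)] by auto
    then have "u \<bullet> v' = 0" unfolding v'_def
      using u v qc q(3) by (simp add: scalar_prod_minus_distrib[of _ n])
    then show ?thesis unfolding p'_def
      using u pc v' p(3) by (simp add: scalar_prod_add_distrib[of _ n])
  qed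
  moreover have "p' \<in> W" unfolding p'_def using closed p(1) v'W by auto
  ultimately show ?case by blast
qed

section \<open>The Moore--Penrose pseudo-inverse from the normal equations\<close>

lemma transpose_scalar_prod:
  fixes A :: "real mat"
  assumes "A \<in> carrier_mat m n" "x \<in> carrier_vec n" "y \<in> carrier_vec m"
  shows "(A *\<^sub>v x) \<bullet> y = x \<bullet> (transpose_mat A *\<^sub>v y)"
proof -
  have "(A *\<^sub>v x) \<bullet> y = y \<bullet> (A *\<^sub>v x)"
    using assms by (intro comm_scalar_prod[of _ m]) auto
  also have "\<dots> = (transpose_mat A *\<^sub>v y) \<bullet> x"
    using transpose_vec_mult_scalar[OF assms] by simp
  also have "\<dots> = x \<bullet> (transpose_mat A *\<^sub>v y)"
    using assms by (intro comm_scalar_prod[of _ n]) auto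
  finally show ?thesis .
qed

text \<open>Project \<open>b\<close> onto the column space of \<open>A\<close>: the residual is
  orthogonal to every column, which is the claim row by row. Taking \<open>W\<close> to be the image
  of \<open>A\<close> makes the projection of the form \<open>A *\<^sub>v x\<close>.\<close>

lemma normal_equations_solvable:
  fixes A :: "real mat"
  assumes A: "A \<in> carrier_mat m n" and b: "b \<in> carrier_vec m"
  shows "\<exists>x\<in>carrier_vec n. transpose_mat A *\<^sub>v (A *\<^sub>v x) = transpose_mat A *\<^sub>v b"
proof -
  let ?W = "(\<lambda>x. A *\<^sub>v x) ` carrier_vec n"
  have cols: "set (cols A) \<subseteq> ?W"
  proof
    fix v assume "v \<in> set (cols A)"
    then obtain i where i: "i < n" "v = col A i" using A by (auto simp: cols_def)
    have "v = A *\<^sub>v unit_vec n i" using A i by (intro eq_vecI) auto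
    then show "v \<in> ?W" by auto
  qed
  have zero: "0\<^sub>v m \<in> ?W"
    by (rule image_eqI[of _ _ "0\<^sub>v n"]) (use A in \<open>auto intro!: eq_vecI\<close>)
  have closed: "x + c \<cdot>\<^sub>v y \<in> ?W" if xy: "x \<in> ?W" "y \<in> ?W" for x y c
  proof -
    obtain a b where "x = A *\<^sub>v a" "y = A *\<^sub>v b" "a \<in> carrier_vec n" "b \<in> carrier_vec n"
      using xy by auto
    then show ?thesis using A
      by (intro image_eqI[of _ _ "a + c \<cdot>\<^sub>v b"])
        (auto simp: mult_add_distrib_mat_vec[of _ m n] mult_mat_vec[of _ m n])
  qed
  have "?W \<subseteq> carrier_vec m" using A by auto
  then obtain x where x: "x \<in> carrier_vec n" "\<And>v. v \<in> set (cols A) \<Longrightarrow> v \<bullet> (b - A *\<^sub>v x) = 0"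
    using orthogonal_projection_exists[OF _ cols _ zero closed b] by blast
  have "transpose_mat A *\<^sub>v (A *\<^sub>v x) = transpose_mat A *\<^sub>v b"
  proof (rule eq_vecI)
    fix i assume "i < dim_vec (transpose_mat A *\<^sub>v b)"
    then have i: "i < n" using A by auto
    then have "col A i \<in> set (cols A)" using A by (auto simp: cols_def)
    then have "col A i \<bullet> (b - A *\<^sub>v x) = 0" using x(2) by auto
    then show "(transpose_mat A *\<^sub>v (A *\<^sub>v x)) $ i = (transpose_mat A *\<^sub>v b) $ i"
      using i A b x(1) by (simp add: scalar_prod_minus_distrib[of _ m])
  qed (use A in auto)
  then show ?thesis using x(1) by blast
qed

text \<open>The columns of \<open>G\<close> solve the normal equations for the unit vectors, so A^T
  (A G) = A^T. Multiplying by G^T shows that (A G)^T (A G) = (A G)^T; the left side is symmetric,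
  hence so is A G, and transposing the first identity gives A G A = A.\<close>

lemma least_squares_inverse_exists:
  fixes A :: "real mat"
  assumes A: "A \<in> carrier_mat m n"
  shows "\<exists>G\<in>carrier_mat n m. A * G * A = A \<and> transpose_mat (A * G) = A * G"
proof -
  have "\<exists>x\<in>carrier_vec n. transpose_mat A *\<^sub>v (A *\<^sub>v x) = transpose_mat A *\<^sub>v unit_vec m i" for i
    by (rule normal_equations_solvable[OF A]) auto
  then obtain x where x: "\<And>i. x i \<in> carrier_vec n"
    "\<And>i. transpose_mat A *\<^sub>v (A *\<^sub>v x i) = transpose_mat A *\<^sub>v unit_vec m i"
    by metis
  define G where "G = mat_of_cols n (map x [0..<m])"
  have G: "G \<in> carrier_mat n m" by (auto simp: G_def)
  have At: "transpose_mat A \<in> carrier_mat n m" using A by auto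
  have AG: "A * G \<in> carrier_mat m m" using A G by auto
  have normal: "transpose_mat A * (A * G) = transpose_mat A"
  proof (rule mat_col_eqI)
    fix i assume "i < dim_col (transpose_mat A)"
    then have i: "i < m" using A by auto
    have "col (transpose_mat A * (A * G)) i = transpose_mat A *\<^sub>v (A *\<^sub>v col G i)"
      using i by (simp add: col_mult2[OF At AG] col_mult2[OF A G])
    also have "col G i = x i" using i x(1) by (simp add: G_def)
    also have "transpose_mat A *\<^sub>v (A *\<^sub>v x i) = col (transpose_mat A) i"
      using i A unfolding x(2) by (intro eq_vecI) auto
    finally show "col (transpose_mat A * (A * G)) i = col (transpose_mat A) i" .
  qed (use A G in auto)
  have "transpose_mat (A * G) * (A * G) = transpose_mat (A * G)"
    unfolding transpose_mult[OF A G] using assoc_mult_mat[OF _ At AG, of "transpose_mat G" m] G normal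
    by simp
  then have "transpose_mat (transpose_mat (A * G) * (A * G)) = A * G"
    by simp
  then have sym: "transpose_mat (A * G) = A * G"
    using transpose_mult[of "transpose_mat (A * G)" m m "A * G" m] AG
      \<open>transpose_mat (A * G) * (A * G) = transpose_mat (A * G)\<close> by simp
  have "transpose_mat (transpose_mat A * (A * G)) = A * G * A"
    using transpose_mult[OF At AG] sym by simp
  then have "A * G * A = A" using normal by simp
  with G sym show ?thesis by blast
qed

text \<open>One least-squares inverse \<open>G\<close> makes \<open>A * G\<close> symmetric;
  another, of the transpose, yields \<open>K\<close> with \<open>K * A\<close> symmetric. The
  product \<open>K * A * G\<close> inherits both symmetries.\<close>

lemma is_pseudo_inverse_exists: "\<exists>B. is_pseudo_inverse A B"
proof -
  define m n where "m = dim_row A" and "n = dim_col A"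
  have A: "A \<in> carrier_mat m n" by (auto simp: m_def n_def)
  obtain G where G: "G \<in> carrier_mat n m" "A * G * A = A" "transpose_mat (A * G) = A * G"
    using least_squares_inverse_exists[OF A] by blast
  have At: "transpose_mat A \<in> carrier_mat n m" using A by auto
  obtain H where H: "H \<in> carrier_mat m n" "transpose_mat A * H * transpose_mat A = transpose_mat A"
    "transpose_mat (transpose_mat A * H) = transpose_mat A * H"
    using least_squares_inverse_exists[OF At] by blast
  define K where "K = transpose_mat H"
  have K: "K \<in> carrier_mat n m" using H by (auto simp: K_def)
  have KA: "transpose_mat A * H = K * A"
    using H(3) transpose_mult[OF At H(1)] by (simp add: K_def)
  have KA_sym: "transpose_mat (K * A) = K * A" using H(3) KA by simp
  have "transpose_mat (K * A * transpose_mat A) = A * (K * A)"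
    using transpose_mult[of "K * A" n n "transpose_mat A" m] K A KA_sym by simp
  then have AKA: "A * (K * A) = A" using H(2) KA by simp
  have GA: "G * A \<in> carrier_mat n n" and AG: "A * G \<in> carrier_mat m m"
    and KAc: "K * A \<in> carrier_mat n n" using A G K by auto
  \<comment> \<open>\<open>A * G\<close> and \<open>K * A\<close> are the orthogonal projections onto the column and the row space.\<close>
  define B where "B = K * A * G"
  have B: "B \<in> carrier_mat n m" using A G K by (auto simp: B_def)
  have AB: "A * B = A * G"
    unfolding B_def using assoc_mult_mat[OF A KAc G(1)] AKA by simp
  have BA: "B * A = K * A"
    unfolding B_def using assoc_mult_mat[OF KAc G(1) A] assoc_mult_mat[OF K A GA]
      assoc_mult_mat[OF A G(1) A] G(2) by simp
  have "B * A * B = B"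
    unfolding BA using assoc_mult_mat[OF K A B] AB assoc_mult_mat[OF K A G(1)] by (simp add: B_def)
  then have "is_pseudo_inverse A B"
    unfolding is_pseudo_inverse_def using A B AB BA G KA_sym by auto
  then show ?thesis by blast
qed

text \<open>The symmetric products A B and A C absorb each other, (A B)(A C) = A C and (A C)(A B) =
  A B, so transposing makes them equal; likewise B A = C A. Then B = B A B = C A B = C A C =
  C.\<close>

lemma is_pseudo_inverse_unique:
  assumes "is_pseudo_inverse A B" "is_pseudo_inverse A C"
  shows "B = C"
proof -
  define m n where "m = dim_row A" and "n = dim_col A"
  have A: "A \<in> carrier_mat m n" by (auto simp: m_def n_def)
  have B: "B \<in> carrier_mat n m" "A * B * A = A" "B * A * B = B"
      "transpose_mat (A * B) = A * B" "transpose_mat (B * A) = B * A"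
    and C: "C \<in> carrier_mat n m" "A * C * A = A" "C * A * C = C"
      "transpose_mat (A * C) = A * C" "transpose_mat (C * A) = C * A"
    using assms by (auto simp: is_pseudo_inverse_def m_def n_def)
  have AB: "A * B \<in> carrier_mat m m" and AC: "A * C \<in> carrier_mat m m"
    and BA: "B * A \<in> carrier_mat n n" and CA: "C * A \<in> carrier_mat n n" using A B C by auto
  have "A * B * (A * C) = A * C" using assoc_mult_mat[OF AB A C(1)] B(2) by simp
  moreover have "A * C * (A * B) = A * B" using assoc_mult_mat[OF AC A B(1)] C(2) by simp
  moreover have "transpose_mat (A * B * (A * C)) = A * C * (A * B)"
    using transpose_mult[OF AB AC] B(4) C(4) by simp
  ultimately have ABC: "A * B = A * C" using C(4) by simp
  have "B * A * (C * A) = B * A"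
    using assoc_mult_mat[OF B(1) A CA] assoc_mult_mat[OF A C(1) A] C(2) by simp
  moreover have "C * A * (B * A) = C * A"
    using assoc_mult_mat[OF C(1) A BA] assoc_mult_mat[OF A B(1) A] B(2) by simp
  moreover have "transpose_mat (B * A * (C * A)) = C * A * (B * A)"
    using transpose_mult[OF BA CA] B(5) C(5) by simp
  ultimately have BCA: "B * A = C * A" using B(5) by simp
  have "B = C * A * B" using B(3) BCA by simp
  also have "\<dots> = C * (A * B)" using assoc_mult_mat[OF C(1) A B(1)] .
  also have "\<dots> = C * A * C" using ABC assoc_mult_mat[OF C(1) A C(1)] by simp
  finally show ?thesis using C(3) by simp
qed

lemma is_pseudo_inverse_pseudo_inverse: "is_pseudo_inverse A (pseudo_inverse A)"
  unfolding pseudo_inverse_def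
  using is_pseudo_inverse_exists is_pseudo_inverse_unique by (metis theI)

section \<open>The spectral norm as an operator bound\<close>

lemma scalar_prod_Cauchy_Schwarz:
  fixes u v :: "real vec"
  assumes "u \<in> carrier_vec n" "v \<in> carrier_vec n"
  shows "(u \<bullet> v)\<^sup>2 \<le> (u \<bullet> u) * (v \<bullet> v)"
  using Cauchy_Schwarz_ineq_sum[of "($) u" "($) v" "{0..<n}"] assms
  by (simp add: scalar_prod_def power2_eq_square)

text \<open>A crude Frobenius bound. It shows that the supremum in \<open>spectral_norm\<close> is
  over a bounded set, and it settles vectors of norm zero, which cannot be normalized.\<close>

lemma mult_mat_vec_norm_bound:
  fixes A :: "real mat"
  assumes "v \<in> carrier_vec (dim_col A)"
  shows "(A *\<^sub>v v) \<bullet> (A *\<^sub>v v) \<le> (\<Sum>i<dim_row A. row A i \<bullet> row A i) * (v \<bullet> v)"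
proof -
  have "(A *\<^sub>v v) \<bullet> (A *\<^sub>v v) = (\<Sum>i<dim_row A. (row A i \<bullet> v)\<^sup>2)"
    by (simp add: scalar_prod_def[of "A *\<^sub>v v"] power2_eq_square lessThan_atLeast0)
  also have "\<dots> \<le> (\<Sum>i<dim_row A. (row A i \<bullet> row A i) * (v \<bullet> v))"
    using assms by (intro sum_mono scalar_prod_Cauchy_Schwarz[of _ "dim_col A"]) auto
  finally show ?thesis by (simp add: sum_distrib_right)
qed

lemma eucl_norm_le_spectral_norm:
  assumes "v \<in> carrier_vec (dim_col A)" "eucl_norm v \<le> 1"
  shows "eucl_norm (A *\<^sub>v v) \<le> spectral_norm A"
  unfolding spectral_norm_def
proof (rule cSUP_upper)
  let ?c = "\<Sum>i<dim_row A. row A i \<bullet> row A i"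
  have c: "0 \<le> ?c" by (intro sum_nonneg) (auto intro: scalar_prod_self_nonneg)
  show "bdd_above ((\<lambda>v. eucl_norm (A *\<^sub>v v)) ` {v \<in> carrier_vec (dim_col A). eucl_norm v \<le> 1})"
  proof (rule bdd_aboveI2)
    fix v assume v: "v \<in> {v \<in> carrier_vec (dim_col A). eucl_norm v \<le> 1}"
    then have "v \<bullet> v \<le> 1" by (simp add: eucl_norm_def)
    then have "?c * (v \<bullet> v) \<le> ?c" using c by (simp add: mult_left_le)
    with mult_mat_vec_norm_bound[of v A] v show "eucl_norm (A *\<^sub>v v) \<le> sqrt ?c"
      by (auto simp: eucl_norm_def intro: order_trans)
  qed
qed (use assms in auto)

lemma spectral_norm_nonneg: "0 \<le> spectral_norm A"
proof -
  have "0 \<le> eucl_norm (A *\<^sub>v 0\<^sub>v (dim_col A))"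
    by (simp add: eucl_norm_def scalar_prod_self_nonneg)
  also have "\<dots> \<le> spectral_norm A"
    by (rule eucl_norm_le_spectral_norm) (auto simp: eucl_norm_def)
  finally show ?thesis .
qed

lemma mult_mat_vec_spectral_norm:
  assumes v: "v \<in> carrier_vec (dim_col A)"
  shows "(A *\<^sub>v v) \<bullet> (A *\<^sub>v v) \<le> (spectral_norm A)\<^sup>2 * (v \<bullet> v)"
proof (cases "v \<bullet> v = 0")
  case True
  then show ?thesis using mult_mat_vec_norm_bound[OF v] by simp
next
  case False
  then have pos: "0 < v \<bullet> v" using scalar_prod_self_nonneg[of v] by simp
  define c where "c = 1 / eucl_norm v"
  have c2: "c\<^sup>2 * (v \<bullet> v) = 1" using pos by (simp add: c_def power_divide eucl_norm_square)
  define u where "u = c \<cdot>\<^sub>v v"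
  have u: "u \<in> carrier_vec (dim_col A)" using v by (auto simp: u_def)
  have "u \<bullet> u = c\<^sup>2 * (v \<bullet> v)" by (simp add: u_def power2_eq_square)
  then have "eucl_norm u \<le> 1" using c2 by (simp add: eucl_norm_def)
  then have "(eucl_norm (A *\<^sub>v u))\<^sup>2 \<le> (spectral_norm A)\<^sup>2"
    by (intro power_mono eucl_norm_le_spectral_norm u) (auto simp: eucl_norm_def scalar_prod_self_nonneg)
  moreover have "A *\<^sub>v u = c \<cdot>\<^sub>v (A *\<^sub>v v)"
    unfolding u_def using v by (intro mult_mat_vec) auto
  ultimately have "c\<^sup>2 * ((A *\<^sub>v v) \<bullet> (A *\<^sub>v v)) \<le> (spectral_norm A)\<^sup>2"
    unfolding eucl_norm_square by (simp add: power2_eq_square mult.assoc)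
  then have "c\<^sup>2 * ((A *\<^sub>v v) \<bullet> (A *\<^sub>v v)) * (v \<bullet> v) \<le> (spectral_norm A)\<^sup>2 * (v \<bullet> v)"
    using pos by (intro mult_right_mono) auto
  moreover have "c\<^sup>2 * ((A *\<^sub>v v) \<bullet> (A *\<^sub>v v)) * (v \<bullet> v) = (A *\<^sub>v v) \<bullet> (A *\<^sub>v v)"
    using c2 by (simp add: mult.assoc mult.left_commute mult.commute[of "v \<bullet> v"])
  ultimately show ?thesis by simp
qed

text \<open>\<open>ARG_MIN\<close> is a choice, so a minimizer has to be exhibited: the projection
  \<open>p\<close> of any solution onto the span of all rows of all tasks. Solutions differ by
  vectors orthogonal to the rows, hence to \<open>p\<close>, and Pythagoras makes \<open>p\<close>
  shortest.\<close>

lemma min_norm_solution_in_joint_solutions: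
  assumes X: "\<And>m. m \<in> {1..T} \<Longrightarrow> X m \<in> carrier_mat (n m) d"
    and ne: "joint_solutions d T X y \<noteq> {}"
  shows "min_norm_solution d T X y \<in> joint_solutions d T X y"
proof -
  obtain w0 where w0: "w0 \<in> joint_solutions d T X y" using ne by blast
  then have w0c: "w0 \<in> carrier_vec d" by (simp add: joint_solutions_def)
  define V where "V = (\<Union>m\<in>{1..T}. set (rows (X m)))"
  have V: "V \<subseteq> carrier_vec d" using X by (force simp: V_def rows_def)
  have fin: "finite V" by (auto simp: V_def)
  obtain p where p: "p \<in> carrier_vec d" "\<And>v. v \<in> V \<Longrightarrow> v \<bullet> (w0 - p) = 0"
      "\<And>u. u \<in> carrier_vec d \<Longrightarrow> (\<And>v. v \<in> V \<Longrightarrow> v \<bullet> u = 0) \<Longrightarrow> u \<bullet> p = 0"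
    using orthogonal_projection_exists[OF fin V subset_refl _ _ w0c] by fastforce
  \<comment> \<open>The solution set is \<open>w0\<close> plus the orthogonal complement of the
    rows.\<close>
  have solution_iff: "w \<in> joint_solutions d T X y \<longleftrightarrow> (\<forall>v\<in>V. v \<bullet> (w - w0) = 0)"
    if w: "w \<in> carrier_vec d" for w
  proof -
    have "X m *\<^sub>v w = y m \<longleftrightarrow> (\<forall>v\<in>set (rows (X m)). v \<bullet> (w - w0) = 0)" if m: "m \<in> {1..T}" for m
    proof -
      have row: "row (X m) i \<in> carrier_vec d" if "i < dim_row (X m)" for i using X[OF m] that by auto
      have "y m = X m *\<^sub>v w0" using w0 m by (simp add: joint_solutions_def)
      then have "X m *\<^sub>v w = y m \<longleftrightarrow> (\<forall>i<dim_row (X m). row (X m) i \<bullet> w = row (X m) i \<bullet> w0)"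
        by (auto simp: vec_eq_iff)
      also have "\<dots> \<longleftrightarrow> (\<forall>i<dim_row (X m). row (X m) i \<bullet> (w - w0) = 0)"
        using row w w0c by (auto simp: scalar_prod_minus_distrib[of _ d])
      finally show ?thesis by (auto simp: rows_def)
    qed
    then show ?thesis using w by (auto simp: joint_solutions_def V_def)
  qed
  have perp: "v \<bullet> (w - w') = 0"
    if "v \<in> V" "v \<bullet> (w - w0) = 0" "v \<bullet> (w' - w0) = 0" "w \<in> carrier_vec d" "w' \<in> carrier_vec d"
    for v w w'
    using that V w0c by (auto simp: scalar_prod_minus_distrib[of _ d] subset_iff)
  have "v \<bullet> (p - w0) = 0" if "v \<in> V" for v
    using perp[OF that, of w0 ] p(1) p(2)[OF that] w0c V that
    by (auto simp: scalar_prod_minus_distrib[of _ d] subset_iff)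
  then have p_sol: "p \<in> joint_solutions d T X y" using solution_iff[OF p(1)] by blast
  have "\<not> eucl_norm w < eucl_norm p" if w: "w \<in> joint_solutions d T X y" for w
  proof -
    have wc: "w \<in> carrier_vec d" using w by (simp add: joint_solutions_def)
    define u where "u = w - p"
    have u: "u \<in> carrier_vec d" and w_eq: "w = u + p" using wc p(1) by (auto simp: u_def)
    have up: "u \<bullet> p = 0"
      using p(3)[OF u] perp[of _ w p] w p_sol solution_iff wc p(1) by (auto simp: u_def)
    have "p \<bullet> u = 0" using up comm_scalar_prod[OF u p(1)] by simp
    then have "w \<bullet> w = u \<bullet> u + p \<bullet> p"
      unfolding w_eq using u p(1) up
      by (simp add: add_scalar_prod_distrib[of _ d] scalar_prod_add_distrib[of _ d])
    then show ?thesis using scalar_prod_self_nonneg[of u] by (simp add: eucl_norm_def)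
  qed
  with p_sol have "is_arg_min eucl_norm (\<lambda>w. w \<in> joint_solutions d T X y) p"
    by (simp add: is_arg_min_def)
  then have "is_arg_min eucl_norm (\<lambda>w. w \<in> joint_solutions d T X y) (min_norm_solution d T X y)"
    unfolding min_norm_solution_def arg_min_def by (rule someI)
  then show ?thesis by (simp add: is_arg_min_def)
qed

section \<open>Averages of orthogonal projections\<close>

text \<open>The purely numerical core: \<open>e\<close> is to be the expected squared error, and
  \<open>drop\<close> says that no stretch of steps loses much more than its first step does, up to
  a factor 4 per step.\<close>

lemma last_decrement_bound:
  fixes e :: "nat \<Rightarrow> real"
  assumes nonneg: "\<And>i. 0 \<le> e i" and decr: "\<And>i. e (Suc i) \<le> e i"
    and drop: "\<And>s j. e s - e (s + j) \<le> 4 * real j * (e s - e (Suc s))"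
  shows "(e k - e (Suc k)) ^ 4 * (real k + 2) \<le> 2 * e 0 ^ 4"
proof -
  have anti: "e (i + j) \<le> e i" for i j
    by (induction j) (auto intro: order_trans[OF decr])
  \<comment> \<open>The product of contraction factors telescopes in this invariant. It is trivial
    at \<open>s = 0\<close>; at \<open>s = k\<close> the remaining factor is 2.\<close>
  have "(e s - e (Suc k)) ^ 4 * (real k + 2) \<le> e 0 ^ 4 * (real (k - s) + 2)" if "s \<le> k" for s
    using that
  proof (induction s)
    case 0
    have "(e 0 - e (Suc k)) ^ 4 \<le> e 0 ^ 4"
      using nonneg anti[of 0 "Suc k"] by (intro power_mono) auto
    then show ?case by (simp add: mult_right_mono)
  next
    case (Suc s)
    define l where "l = k - s"
    have l: "1 \<le> l" "k - Suc s = l - 1" "s + Suc l = Suc k" using Suc.prems by (auto simp: l_def)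
    \<comment> \<open>\<open>x\<close> is the number of steps from \<open>s\<close> to
      \<open>Suc k\<close>, the horizon at which \<open>drop\<close> is used.\<close>
    define x where "x = real l + 1"
    have x: "x \<ge> 2" using l by (simp add: x_def)
    define S S' where "S = e s - e (Suc k)" and "S' = e (Suc s) - e (Suc k)"
    have S': "0 \<le> S'" using anti[of "Suc s" l] l by (simp add: S'_def)
    have "S \<le> 4 * x * (S - S')"
      using drop[of s "Suc l"] l by (simp add: S_def S'_def x_def add.commute)
    then have S'S: "4 * x * S' \<le> (4 * x - 1) * S" by (simp add: algebra_simps)
    \<comment> \<open>This is (1 - 1/(4x))^4 \<le> x/(x+1) without denominators. Bernoulli is
      applied to the reciprocal: (1 + 1/(4x-1))^4 \<ge> 1 + 4/(4x-1) \<ge> 1 + 1/x.\<close>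
    have bern: "(4 * x - 1) ^ 4 * (x + 1) \<le> (4 * x) ^ 4 * x"
    proof -
      have "1 + 4 * (1 / (4 * x - 1)) \<le> (1 + 1 / (4 * x - 1)) ^ 4"
        using x Bernoulli_inequality[of "1 / (4 * x - 1)" 4] order_trans[of "- 1" 0 "1 / (4 * x - 1)"]
        by simp
      also have "1 + 1 / (4 * x - 1) = 4 * x / (4 * x - 1)" using x by (simp add: field_simps)
      finally have "(4 * x - 1) ^ 4 * (1 + 4 * (1 / (4 * x - 1))) \<le> (4 * x) ^ 4"
        using x by (simp add: power_divide pos_le_divide_eq mult.commute)
      moreover have "1 + 1 / x \<le> 1 + 4 * (1 / (4 * x - 1))" using x by (simp add: field_simps)
      ultimately have "(4 * x - 1) ^ 4 * (1 + 1 / x) \<le> (4 * x) ^ 4"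
        using x by (smt (verit) mult_left_mono zero_le_power)
      then have "(4 * x - 1) ^ 4 * (1 + 1 / x) * x \<le> (4 * x) ^ 4 * x"
        using x by (intro mult_right_mono) auto
      moreover have "(1 + 1 / x) * x = x + 1" using x by (simp add: field_simps)
      ultimately show ?thesis by (simp only: mult.assoc)
    qed
    have "(4 * x * S') ^ 4 \<le> ((4 * x - 1) * S) ^ 4"
      using S'S S' x by (intro power_mono) auto
    then have "(4 * x) ^ 4 * S' ^ 4 * (x + 1) \<le> (4 * x - 1) ^ 4 * S ^ 4 * (x + 1)"
      using x by (intro mult_right_mono) (auto simp: power_mult_distrib)
    also have "\<dots> = S ^ 4 * ((4 * x - 1) ^ 4 * (x + 1))" by (simp add: mult_ac)
    also have "\<dots> \<le> S ^ 4 * ((4 * x) ^ 4 * x)" by (intro mult_left_mono bern) auto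
    finally have "(4 * x) ^ 4 * (S' ^ 4 * (x + 1)) \<le> (4 * x) ^ 4 * (S ^ 4 * x)"
      by (simp add: mult_ac)
    then have step: "S' ^ 4 * (x + 1) \<le> S ^ 4 * x" using x by (simp add: mult_le_cancel_left_pos)
    have IH: "S ^ 4 * (real k + 2) \<le> e 0 ^ 4 * (x + 1)"
      using Suc by (simp add: S_def l_def x_def add.commute add.left_commute)
    have "(x + 1) * (S' ^ 4 * (real k + 2)) \<le> x * (S ^ 4 * (real k + 2))"
      using mult_right_mono[OF step, of "real k + 2"] by (simp add: mult_ac)
    also have "\<dots> \<le> x * (e 0 ^ 4 * (x + 1))" using IH x by (intro mult_left_mono) auto
    finally have "(x + 1) * (S' ^ 4 * (real k + 2)) \<le> (x + 1) * (e 0 ^ 4 * x)" by (simp add: mult_ac)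
    then have "S' ^ 4 * (real k + 2) \<le> e 0 ^ 4 * x" using x by (simp add: mult_le_cancel_left_pos)
    moreover have "real (k - Suc s) + 2 = x" using l by (simp add: x_def)
    ultimately show ?case by (simp only: S'_def)
  qed
  from this[of k] show ?thesis by (simp add: mult.commute)
qed

lemma le_divide_root4:
  fixes a b c :: real
  assumes "a ^ 4 * c \<le> b ^ 4" "0 \<le> b" "0 < c"
  shows "a \<le> b / root 4 c"
proof (rule power_le_imp_le_base)
  have "(b / root 4 c) ^ Suc 3 = b ^ 4 / c"
    using assms(3) by (simp add: power_divide)
  then show "a ^ Suc 3 \<le> (b / root 4 c) ^ Suc 3"
    using assms by (simp add: pos_le_divide_eq)
qed (use assms in auto)

section \<open>Projection steps and their averages\<close>

lemma scalar_prod_add_self_le: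
  fixes u v :: "real vec"
  assumes "u \<in> carrier_vec n" "v \<in> carrier_vec n"
  shows "(u + v) \<bullet> (u + v) \<le> 2 * (u \<bullet> u) + 2 * (v \<bullet> v)"
proof -
  have "0 \<le> (u - v) \<bullet> (u - v)" by (rule scalar_prod_self_nonneg)
  then show ?thesis using assms
    by (simp add: add_scalar_prod_distrib[of _ n] scalar_prod_add_distrib[of _ n]
        minus_scalar_prod_distrib[of _ n] scalar_prod_minus_distrib[of _ n])
qed

text \<open>The estimates see a task only through the orthogonal projection onto its row space.
  Symmetric idempotent matrices capture this, and vectors \<open>z\<close> stand for errors relative
  to a joint solution.\<close>

locale random_projections =
  fixes d T :: nat and Q :: "nat \<Rightarrow> real mat"
  assumes T_pos: "1 \<le> T"
    and Q_carrier: "\<And>m. m \<in> {1..T} \<Longrightarrow> Q m \<in> carrier_mat d d"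
    and Q_sym: "\<And>m. m \<in> {1..T} \<Longrightarrow> transpose_mat (Q m) = Q m"
    and Q_idem: "\<And>m. m \<in> {1..T} \<Longrightarrow> Q m * Q m = Q m"
begin

definition step :: "nat \<Rightarrow> real vec \<Rightarrow> real vec" where
  "step m z = z - Q m *\<^sub>v z"

definition res :: "nat \<Rightarrow> real vec \<Rightarrow> real" where
  "res m z = (Q m *\<^sub>v z) \<bullet> (Q m *\<^sub>v z)"

text \<open>\<open>(avg ^^ j) h z\<close> is the expectation of \<open>h\<close> after \<open>j\<close> random steps from \<open>z\<close>.\<close>
definition avg :: "(real vec \<Rightarrow> real) \<Rightarrow> real vec \<Rightarrow> real" where
  "avg h z = (\<Sum>m=1..T. h (step m z)) / real T"

text \<open>For initial error \<open>z\<close>, \<open>(avg ^^ i) mean_res z\<close> is the quantity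
  a_i of the overview: the observed task is drawn independently of the \<open>i\<close>
  steps.\<close>

definition mean_res :: "real vec \<Rightarrow> real" where
  "mean_res z = (\<Sum>m=1..T. res m z) / real T"

lemma Q_mult_carrier:
  assumes "m \<in> {1..T}" "z \<in> carrier_vec d"
  shows "Q m *\<^sub>v z \<in> carrier_vec d"
  using Q_carrier[OF assms(1)] assms(2) by auto

lemma step_carrier:
  assumes "m \<in> {1..T}" "z \<in> carrier_vec d"
  shows "step m z \<in> carrier_vec d"
  using Q_mult_carrier[OF assms] assms(2) by (auto simp: step_def)

lemma Q_scalar_prod:
  assumes m: "m \<in> {1..T}" and z: "z \<in> carrier_vec d" and u: "u \<in> carrier_vec d"
  shows "(Q m *\<^sub>v z) \<bullet> u = (Q m *\<^sub>v z) \<bullet> (Q m *\<^sub>v u)"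
proof -
  have "Q m *\<^sub>v (Q m *\<^sub>v u) = Q m *\<^sub>v u"
    using assoc_mult_mat_vec[OF Q_carrier[OF m] Q_carrier[OF m] u] Q_idem[OF m] by simp
  then show ?thesis
    using transpose_scalar_prod[OF Q_carrier[OF m] z u] Q_sym[OF m]
      transpose_scalar_prod[OF Q_carrier[OF m] z Q_mult_carrier[OF m u]] by simp
qed

text \<open>The reference point \<open>u\<close> stays free for three uses: \<open>u\<close> zero
  gives Pythagoras, \<open>u = z\<close> the length of a step, and general \<open>u\<close> the
  cross term in \<open>square_drop_le\<close>.\<close>

lemma step_diff_square:
  assumes m: "m \<in> {1..T}" and z: "z \<in> carrier_vec d" and u: "u \<in> carrier_vec d"
  shows "(step m z - u) \<bullet> (step m z - u)
       = (z - u) \<bullet> (z - u) - res m z + 2 * ((Q m *\<^sub>v z) \<bullet> (Q m *\<^sub>v u))"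
proof -
  define q where "q = Q m *\<^sub>v z"
  have q: "q \<in> carrier_vec d" using Q_mult_carrier[OF m z] by (simp add: q_def)
  have qz: "q \<bullet> z = q \<bullet> q" and qu: "q \<bullet> u = q \<bullet> (Q m *\<^sub>v u)"
    using Q_scalar_prod[OF m z z] Q_scalar_prod[OF m z u] by (auto simp: q_def)
  have comm: "z \<bullet> q = q \<bullet> z" "u \<bullet> q = q \<bullet> u" "u \<bullet> z = z \<bullet> u"
    using comm_scalar_prod q z u by blast+
  have "step m z - u = (z - u) - q"
    unfolding step_def q_def[symmetric] using z u q by auto
  then have "(step m z - u) \<bullet> (step m z - u)
      = (z - u) \<bullet> (z - u) + q \<bullet> q - 2 * (q \<bullet> z) + 2 * (q \<bullet> u)"
    using z u q by (simp add: minus_scalar_prod_distrib[of _ d] scalar_prod_minus_distrib[of _ d] comm)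
  then show ?thesis unfolding qz qu by (simp add: res_def q_def)
qed

lemma step_square:
  assumes "m \<in> {1..T}" "z \<in> carrier_vec d"
  shows "step m z \<bullet> step m z = z \<bullet> z - res m z"
proof -
  have "Q m *\<^sub>v 0\<^sub>v d = 0\<^sub>v d" using Q_carrier[OF assms(1)] by (intro eq_vecI) auto
  then show ?thesis
    using step_diff_square[OF assms, of "0\<^sub>v d"] assms(2) step_carrier[OF assms]
      Q_mult_carrier[OF assms] by simp
qed

lemma res_nonneg: "0 \<le> res m z"
  by (simp add: res_def scalar_prod_self_nonneg)

lemma res_le:
  assumes "m \<in> {1..T}" "z \<in> carrier_vec d"
  shows "res m z \<le> z \<bullet> z"
  using step_square[OF assms] scalar_prod_self_nonneg[of "step m z"] by simp

lemma mean_res_nonneg: "0 \<le> mean_res z"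
  by (simp add: mean_res_def sum_nonneg res_nonneg)

lemma avg_square:
  assumes "z \<in> carrier_vec d"
  shows "avg (\<lambda>z. z \<bullet> z) z = z \<bullet> z - mean_res z"
proof -
  have "(\<Sum>m=1..T. step m z \<bullet> step m z) = (\<Sum>m=1..T. z \<bullet> z - res m z)"
    using assms by (intro sum.cong step_square) auto
  then show ?thesis
    using T_pos by (simp add: avg_def mean_res_def sum_subtractf diff_divide_distrib)
qed

text \<open>Explicit coefficients cover sums, differences and multiples at once; factors such as
  \<open>1 *\<close> and \<open>(- 1) *\<close> below serve to match this form.\<close>

lemma avg_pow_lincomb:
  "(avg ^^ j) (\<lambda>z. a * h z + b * g z) = (\<lambda>z. a * (avg ^^ j) h z + b * (avg ^^ j) g z)"
proof (induction j)
  case (Suc j)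
  then show ?case
    by (simp add: avg_def fun_eq_iff sum.distrib sum_distrib_left[symmetric] add_divide_distrib)
qed simp

lemma avg_mono:
  assumes "\<And>x. x \<in> carrier_vec d \<Longrightarrow> h x \<le> g x" "z \<in> carrier_vec d"
  shows "avg h z \<le> avg g z"
  unfolding avg_def using assms by (intro divide_right_mono sum_mono assms(1) step_carrier) auto

lemma avg_pow_mono:
  assumes "\<And>x. x \<in> carrier_vec d \<Longrightarrow> h x \<le> g x" "z \<in> carrier_vec d"
  shows "(avg ^^ j) h z \<le> (avg ^^ j) g z"
  using assms(2) by (induction j arbitrary: z) (auto intro: assms(1) avg_mono)

lemma avg_pow_cong:
  assumes "\<And>x. x \<in> carrier_vec d \<Longrightarrow> h x = g x" "z \<in> carrier_vec d"
  shows "(avg ^^ j) h z = (avg ^^ j) g z"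
  using assms by (intro antisym avg_pow_mono) auto

lemma avg_pow_nonneg:
  assumes "\<And>x. x \<in> carrier_vec d \<Longrightarrow> 0 \<le> h x" "z \<in> carrier_vec d"
  shows "0 \<le> (avg ^^ j) h z"
proof -
  have "0 = (avg ^^ j) (\<lambda>z. 0) z" using avg_pow_lincomb[of j 0 "\<lambda>z. 0" 0 "\<lambda>z. 0"] by simp
  also have "\<dots> \<le> (avg ^^ j) h z" by (intro avg_pow_mono assms)
  finally show ?thesis .
qed

lemma avg_add_const: "avg (\<lambda>z. h z + c) z = avg h z + c"
  using T_pos by (simp add: avg_def sum.distrib field_simps)

lemma avg_pow_drift:
  assumes "\<And>x. x \<in> carrier_vec d \<Longrightarrow> avg h x \<le> h x + c" "z \<in> carrier_vec d"
  shows "(avg ^^ j) h z \<le> h z + real j * c"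
  using assms(2)
proof (induction j arbitrary: z)
  case (Suc j)
  have "(avg ^^ Suc j) h z \<le> avg (\<lambda>x. h x + real j * c) z"
    using avg_mono[OF Suc.IH Suc.prems] by simp
  also have "\<dots> \<le> h z + real (Suc j) * c"
    using assms(1)[OF Suc.prems] by (simp add: avg_add_const algebra_simps)
  finally show ?case .
qed simp

text \<open>The mixed potential \<open>\<parallel>z - u\<parallel>\<^sup>2 - \<parallel>z\<parallel>\<^sup>2 / 2\<close> grows by at most
  \<open>2 * mean_res u\<close> per averaged step, since the cross term \<open>2 (Q z) \<bullet> (Q u)\<close> is at most
  \<open>\<parallel>Q z\<parallel>\<^sup>2 / 2 + 2 \<parallel>Q u\<parallel>\<^sup>2\<close>; start it at \<open>z = u\<close>.\<close>
lemma square_drop_le: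
  assumes u: "u \<in> carrier_vec d"
  shows "u \<bullet> u - (avg ^^ j) (\<lambda>z. z \<bullet> z) u \<le> 4 * real j * mean_res u"
proof -
  define h where "h = (\<lambda>z. 1 * ((z - u) \<bullet> (z - u)) + (- 1 / 2) * (z \<bullet> z))"
  have "avg h z \<le> h z + 2 * mean_res u" if z: "z \<in> carrier_vec d" for z
  proof -
    have "h (step m z) \<le> h z + 2 * res m u" if m: "m \<in> {1..T}" for m
    proof -
      define p q where "p = Q m *\<^sub>v z" and "q = Q m *\<^sub>v u"
      have pq: "p \<in> carrier_vec d" "q \<in> carrier_vec d"
        using Q_mult_carrier[OF m] z u by (auto simp: p_def q_def)
      have "0 \<le> (p - 2 \<cdot>\<^sub>v q) \<bullet> (p - 2 \<cdot>\<^sub>v q)" by (rule scalar_prod_self_nonneg)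
      also have "\<dots> = p \<bullet> p - 4 * (p \<bullet> q) + 4 * (q \<bullet> q)"
        using pq comm_scalar_prod[OF pq]
        by (simp add: minus_scalar_prod_distrib[of _ d] scalar_prod_minus_distrib[of _ d])
      finally show ?thesis
        using step_diff_square[OF m z u] step_square[OF m z]
        unfolding h_def res_def p_def[symmetric] q_def[symmetric] by linarith
    qed
    then have "(\<Sum>m=1..T. h (step m z)) \<le> (\<Sum>m=1..T. h z + 2 * res m u)"
      by (intro sum_mono) auto
    also have "\<dots> = real T * h z + 2 * (\<Sum>m=1..T. res m u)"
      by (simp add: sum.distrib sum_distrib_left)
    finally have "avg h z \<le> (real T * h z + 2 * (\<Sum>m=1..T. res m u)) / real T"
      unfolding avg_def by (intro divide_right_mono) auto
    then show ?thesis using T_pos by (simp add: mean_res_def add_divide_distrib)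
  qed
  then have "(avg ^^ j) h u \<le> h u + real j * (2 * mean_res u)" by (rule avg_pow_drift[OF _ u])
  moreover have "h u = - 1 / 2 * (u \<bullet> u)" using u by (simp add: h_def)
  moreover have "(avg ^^ j) h u = (avg ^^ j) (\<lambda>z. (z - u) \<bullet> (z - u)) u - 1 / 2 * (avg ^^ j) (\<lambda>z. z \<bullet> z) u"
    unfolding h_def avg_pow_lincomb by simp
  \<comment> \<open>Discarding the expected squared distance to \<open>u\<close> leaves exactly half
    of the claim.\<close>
  moreover have "0 \<le> (avg ^^ j) (\<lambda>z. (z - u) \<bullet> (z - u)) u"
    by (intro avg_pow_nonneg scalar_prod_self_nonneg u)
  ultimately show ?thesis by linarith
qed

text \<open>Averaging Pythagoras over \<open>i\<close> earlier steps turns each mean residual into a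
  decrement of the expected squared error, so that sums telescope.\<close>

lemma avg_pow_mean_res:
  assumes "z \<in> carrier_vec d"
  shows "(avg ^^ i) mean_res z = (avg ^^ i) (\<lambda>z. z \<bullet> z) z - (avg ^^ Suc i) (\<lambda>z. z \<bullet> z) z"
proof -
  have "(avg ^^ i) mean_res z = (avg ^^ i) (\<lambda>z. 1 * (z \<bullet> z) + (- 1) * avg (\<lambda>z. z \<bullet> z) z) z"
    by (rule avg_pow_cong) (auto simp: avg_square assms)
  then show ?thesis unfolding avg_pow_lincomb by (simp add: funpow_swap1)
qed

lemma mean_res_decay:
  assumes z: "z \<in> carrier_vec d"
  shows "((avg ^^ k) mean_res z) ^ 4 * (real k + 2) \<le> 2 * (z \<bullet> z) ^ 4"
proof -
  define e where "e i = (avg ^^ i) (\<lambda>z. z \<bullet> z) z" for i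
  have diff: "e i - e (Suc i) = (avg ^^ i) mean_res z" for i
    unfolding e_def avg_pow_mean_res[OF z] ..
  \<comment> \<open>\<open>square_drop_le\<close> holds from every starting point, so it may be
    averaged over the position reached after \<open>s\<close> steps.\<close>
  have "e s - e (s + j) \<le> 4 * real j * (e s - e (Suc s))" for s j
  proof -
    have "e s - e (s + j) = (avg ^^ s) (\<lambda>x. 1 * (x \<bullet> x) + (- 1) * (avg ^^ j) (\<lambda>z. z \<bullet> z) x) z"
      unfolding avg_pow_lincomb by (simp add: e_def funpow_add)
    also have "\<dots> \<le> (avg ^^ s) (\<lambda>x. (4 * real j) * mean_res x + 0 * mean_res x) z"
      using square_drop_le by (intro avg_pow_mono z) auto
    finally show ?thesis unfolding avg_pow_lincomb diff by simp
  qed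
  moreover have "0 \<le> e i" for i
    unfolding e_def by (intro avg_pow_nonneg z scalar_prod_self_nonneg)
  moreover have "e (Suc i) \<le> e i" for i
    using diff[of i] avg_pow_nonneg[of mean_res z i] mean_res_nonneg z by simp
  ultimately have "(e k - e (Suc k)) ^ 4 * (real k + 2) \<le> 2 * e 0 ^ 4"
    by (intro last_decrement_bound)
  then show ?thesis by (simp add: diff) (simp add: e_def)
qed

section \<open>Residuals of tasks visited in the past\<close>

lemma sum_avg_pow_mean_res_le:
  assumes z: "z \<in> carrier_vec d"
  shows "(\<Sum>i<k. (avg ^^ i) mean_res z) \<le> z \<bullet> z"
proof -
  have "(\<Sum>i<k. (avg ^^ i) mean_res z) = z \<bullet> z - (avg ^^ k) (\<lambda>z. z \<bullet> z) z"
    unfolding avg_pow_mean_res[OF z]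
    using sum_lessThan_telescope'[of "\<lambda>i. (avg ^^ i) (\<lambda>z. z \<bullet> z) z" k] by simp
  then show ?thesis using avg_pow_nonneg[of "\<lambda>z. z \<bullet> z" z k] scalar_prod_self_nonneg z by simp
qed

text \<open>Used with \<open>x = step m y\<close> to forget that task \<open>m\<close> has already been visited.\<close>
lemma avg_pow_res_stable:
  assumes m: "m \<in> {1..T}" and "x \<in> carrier_vec d" "y \<in> carrier_vec d"
  shows "(avg ^^ j) (res m) x \<le> 2 * (avg ^^ j) (res m) y + 2 * ((x - y) \<bullet> (x - y))"
  using assms(2,3)
proof (induction j arbitrary: x y)
  case 0
  have xy: "x - y \<in> carrier_vec d" using 0 by auto
  have "Q m *\<^sub>v x = Q m *\<^sub>v y + Q m *\<^sub>v (x - y)"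
    unfolding mult_minus_distrib_mat_vec[OF Q_carrier[OF m] 0]
    using Q_mult_carrier[OF m 0(1)] Q_mult_carrier[OF m 0(2)] by (intro eq_vecI) auto
  then have "res m x \<le> 2 * res m y + 2 * res m (x - y)"
    using scalar_prod_add_self_le[OF Q_mult_carrier[OF m 0(2)] Q_mult_carrier[OF m xy]]
    by (simp add: res_def)
  then show ?case using res_le[OF m xy] by simp
next
  case (Suc j)
  have xy: "x - y \<in> carrier_vec d" using Suc.prems by auto
  \<comment> \<open>A coupling: both trajectories take the same step \<open>i\<close>. It is linear
    and does not increase lengths, so their distance stays controlled.\<close>
  have "(avg ^^ j) (res m) (step i x) \<le> 2 * (avg ^^ j) (res m) (step i y) + 2 * ((x - y) \<bullet> (x - y))"
    if i: "i \<in> {1..T}" for i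
  proof -
    have "step i x - step i y = step i (x - y)"
      unfolding step_def mult_minus_distrib_mat_vec[OF Q_carrier[OF i] Suc.prems]
      using Suc.prems Q_carrier[OF i] Q_mult_carrier[OF i Suc.prems(1)] Q_mult_carrier[OF i Suc.prems(2)]
      by (intro eq_vecI) auto
    then have "(step i x - step i y) \<bullet> (step i x - step i y) \<le> (x - y) \<bullet> (x - y)"
      using step_square[OF i xy] res_nonneg[of i "x - y"] by simp
    then show ?thesis
      using Suc.IH[OF step_carrier[OF i Suc.prems(1)] step_carrier[OF i Suc.prems(2)]] by simp
  qed
  then have "(\<Sum>i=1..T. (avg ^^ j) (res m) (step i x))
      \<le> (\<Sum>i=1..T. 2 * (avg ^^ j) (res m) (step i y) + 2 * ((x - y) \<bullet> (x - y)))"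
    by (intro sum_mono) auto
  also have "\<dots> = 2 * (\<Sum>i=1..T. (avg ^^ j) (res m) (step i y)) + real T * (2 * ((x - y) \<bullet> (x - y)))"
    by (simp add: sum.distrib sum_distrib_left)
  finally have "avg ((avg ^^ j) (res m)) x
      \<le> (2 * (\<Sum>i=1..T. (avg ^^ j) (res m) (step i y)) + real T * (2 * ((x - y) \<bullet> (x - y)))) / real T"
    unfolding avg_def[of _ x] by (intro divide_right_mono) auto
  also have "\<dots> = 2 * avg ((avg ^^ j) (res m)) y + 2 * ((x - y) \<bullet> (x - y))"
    using T_pos by (simp add: avg_def[of _ y] add_divide_distrib)
  finally show ?case by simp
qed

lemma avg_pow_mean_res_eq_sum:
  "(avg ^^ j) mean_res z = (\<Sum>m=1..T. (avg ^^ j) (res m) z) / real T"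
proof (induction j arbitrary: z)
  case (Suc j)
  have "(avg ^^ Suc j) mean_res z
      = (\<Sum>i=1..T. (\<Sum>m=1..T. (avg ^^ j) (res m) (step i z)) / real T) / real T"
    by (simp add: avg_def[of _ z] Suc.IH)
  also have "\<dots> = (\<Sum>m=1..T. (\<Sum>i=1..T. (avg ^^ j) (res m) (step i z)) / real T) / real T"
    by (subst (1 2) sum_divide_distrib[symmetric], subst sum.swap) simp
  finally show ?case by (simp add: avg_def[of _ z])
qed (simp add: mean_res_def)

text \<open>Compare with the trajectory that omits the first visit to \<open>m\<close>. It starts at
  \<open>z\<close> independently of \<open>m\<close>, so averaging over \<open>m\<close> gives
  \<open>mean_res\<close>; the omitted step has squared length \<open>res m z\<close>.\<close>

lemma revisit_le:
  assumes z: "z \<in> carrier_vec d"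
  shows "(\<Sum>m=1..T. (avg ^^ j) (res m) (step m z)) / real T
       \<le> 2 * (avg ^^ j) mean_res z + 2 * mean_res z"
proof -
  have "(avg ^^ j) (res m) (step m z) \<le> 2 * (avg ^^ j) (res m) z + 2 * res m z" if m: "m \<in> {1..T}" for m
  proof -
    have "(step m z - z) \<bullet> (step m z - z) = res m z"
      using step_diff_square[OF m z z] z by (simp add: res_def)
    then show ?thesis using avg_pow_res_stable[OF m step_carrier[OF m z] z, of j] by simp
  qed
  then have "(\<Sum>m=1..T. (avg ^^ j) (res m) (step m z))
      \<le> (\<Sum>m=1..T. 2 * (avg ^^ j) (res m) z + 2 * res m z)"
    by (intro sum_mono) auto
  also have "\<dots> = 2 * (\<Sum>m=1..T. (avg ^^ j) (res m) z) + 2 * (\<Sum>m=1..T. res m z)"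
    by (simp add: sum.distrib sum_distrib_left)
  finally have "(\<Sum>m=1..T. (avg ^^ j) (res m) (step m z)) / real T
      \<le> (2 * (\<Sum>m=1..T. (avg ^^ j) (res m) z) + 2 * (\<Sum>m=1..T. res m z)) / real T"
    by (intro divide_right_mono) auto
  then show ?thesis
    unfolding avg_pow_mean_res_eq_sum mean_res_def by (simp add: add_divide_distrib)
qed

lemma avg_pow_revisit_le:
  assumes z: "z \<in> carrier_vec d"
  shows "(avg ^^ s) (\<lambda>z. (\<Sum>m=1..T. (avg ^^ j) (res m) (step m z)) / real T) z
       \<le> 2 * (avg ^^ (s + j)) mean_res z + 2 * (avg ^^ s) mean_res z"
proof -
  have "(avg ^^ s) (\<lambda>z. (\<Sum>m=1..T. (avg ^^ j) (res m) (step m z)) / real T) z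
      \<le> (avg ^^ s) (\<lambda>z. 2 * (avg ^^ j) mean_res z + 2 * mean_res z) z"
    by (intro avg_pow_mono revisit_le z)
  then show ?thesis unfolding avg_pow_lincomb by (simp add: funpow_add)
qed

end

section \<open>Random task orderings\<close>

lemma finite_set_random_ordering:
  assumes "1 \<le> T"
  shows "finite (set_pmf (random_ordering T k))"
  unfolding random_ordering_def using assms
  by (subst set_Pi_pmf) (auto intro!: finite_PiE_dflt)

lemma random_ordering_range:
  assumes "1 \<le> T" "\<tau> \<in> set_pmf (random_ordering T k)" "t \<in> {1..k}"
  shows "\<tau> t \<in> {1..T}"
  using assms unfolding random_ordering_def
  by (subst (asm) set_Pi_pmf) (auto simp: PiE_dflt_def)

lemma expectation_random_ordering_mono:
  fixes f g :: "(nat \<Rightarrow> nat) \<Rightarrow> real"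
  assumes "1 \<le> T" "\<And>\<tau>. \<tau> \<in> set_pmf (random_ordering T k) \<Longrightarrow> f \<tau> \<le> g \<tau>"
  shows "measure_pmf.expectation (random_ordering T k) f \<le> measure_pmf.expectation (random_ordering T k) g"
  using assms
  by (intro integral_mono_AE integrable_measure_pmf_finite finite_set_random_ordering)
    (auto simp: AE_measure_pmf_iff)

text \<open>The last task is an independent uniform draw on top of an ordering of the first
  \<open>k\<close>. Finite support makes every integrand integrable.\<close>

lemma expectation_random_ordering_Suc:
  fixes f :: "(nat \<Rightarrow> nat) \<Rightarrow> real"
  assumes T: "1 \<le> T"
  shows "measure_pmf.expectation (random_ordering T (Suc k)) f
       = measure_pmf.expectation (random_ordering T k) (\<lambda>\<tau>. (\<Sum>m=1..T. f (\<tau>(Suc k := m))) / real T)"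
proof -
  have "random_ordering T (Suc k)
      = pmf_of_set {1..T} \<bind> (\<lambda>m. map_pmf (\<lambda>\<tau>. \<tau>(Suc k := m)) (random_ordering T k))"
    using Pi_pmf_insert'[of "{1..k}" "Suc k" 0 "\<lambda>_. pmf_of_set {1..T}"]
    by (simp add: random_ordering_def map_pmf_def atLeastAtMostSuc_conv)
  then have "measure_pmf.expectation (random_ordering T (Suc k)) f
      = (\<Sum>m=1..T. measure_pmf.expectation (random_ordering T k) (\<lambda>\<tau>. f (\<tau>(Suc k := m)))) / real T"
    using T finite_set_random_ordering[OF T, of k]
    by (simp add: pmf_expectation_bind_pmf_of_set sum_distrib_left divide_inverse mult.commute)
  then show ?thesis
    using finite_set_random_ordering[OF T, of k]
    by (simp add: Bochner_Integration.integral_sum integrable_measure_pmf_finite)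
qed

section \<open>Expectations along random trajectories\<close>

context random_projections
begin

primrec traj :: "real vec \<Rightarrow> (nat \<Rightarrow> nat) \<Rightarrow> nat \<Rightarrow> real vec" where
  "traj z \<tau> 0 = z"
| "traj z \<tau> (Suc t) = step (\<tau> (Suc t)) (traj z \<tau> t)"

lemma traj_upd: "t < s \<Longrightarrow> traj z (\<tau>(s := m)) t = traj z \<tau> t"
  by (induction t) auto

lemma traj_carrier:
  assumes "z \<in> carrier_vec d" "\<And>s. s \<in> {1..t} \<Longrightarrow> \<tau> s \<in> {1..T}"
  shows "traj z \<tau> t \<in> carrier_vec d"
  using assms(2) by (induction t) (auto intro!: assms(1) step_carrier)

text \<open>The induction removes the last task and absorbs its average into \<open>h\<close>, which
  is therefore arbitrary.\<close>

lemma expectation_traj: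
  "measure_pmf.expectation (random_ordering T k) (\<lambda>\<tau>. h (traj z \<tau> k)) = (avg ^^ k) h z"
proof (induction k arbitrary: h)
  case 0
  show ?case by (simp add: random_ordering_def)
next
  case (Suc k)
  have "measure_pmf.expectation (random_ordering T (Suc k)) (\<lambda>\<tau>. h (traj z \<tau> (Suc k)))
      = measure_pmf.expectation (random_ordering T k) (\<lambda>\<tau>. avg h (traj z \<tau> k))"
    by (simp add: expectation_random_ordering_Suc[OF T_pos] traj_upd avg_def)
  also have "\<dots> = (avg ^^ Suc k) h z" unfolding Suc.IH by (simp add: funpow_swap1)
  finally show ?case .
qed

text \<open>Only the \<open>j\<close> tasks after \<open>t\<close> are averaged out. The observable
  \<open>G\<close> may depend on \<open>\<tau> t\<close>, which those averages leave fixed.\<close>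

lemma expectation_past_task_traj:
  assumes "1 \<le> t"
  shows "measure_pmf.expectation (random_ordering T (t + j)) (\<lambda>\<tau>. G (\<tau> t) (traj z \<tau> (t + j)))
       = measure_pmf.expectation (random_ordering T t) (\<lambda>\<tau>. (avg ^^ j) (G (\<tau> t)) (traj z \<tau> t))"
proof (induction j arbitrary: G)
  case (Suc j)
  have "measure_pmf.expectation (random_ordering T (t + Suc j)) (\<lambda>\<tau>. G (\<tau> t) (traj z \<tau> (t + Suc j)))
      = measure_pmf.expectation (random_ordering T (t + j)) (\<lambda>\<tau>. avg (G (\<tau> t)) (traj z \<tau> (t + j)))"
    by (simp add: expectation_random_ordering_Suc[OF T_pos] traj_upd avg_def)
  also have "\<dots> = measure_pmf.expectation (random_ordering T t)
      (\<lambda>\<tau>. (avg ^^ Suc j) (G (\<tau> t)) (traj z \<tau> t))"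
    unfolding Suc.IH[of "\<lambda>m. avg (G m)"] by (simp add: funpow_swap1)
  finally show ?case .
qed simp

lemma expectation_past_res_le:
  assumes z: "z \<in> carrier_vec d" and t: "t \<in> {1..k}"
  shows "measure_pmf.expectation (random_ordering T k) (\<lambda>\<tau>. res (\<tau> t) (traj z \<tau> k))
       \<le> 2 * (avg ^^ (k - 1)) mean_res z + 2 * (avg ^^ (t - 1)) mean_res z"
proof -
  \<comment> \<open>\<open>s\<close> steps precede the visit at time \<open>t\<close>, and
    \<open>j\<close> follow it.\<close>
  define s j where "s = t - 1" and "j = k - t"
  have ts: "t = Suc s" and k: "k = t + j" and "k - 1 = s + j" using t by (auto simp: s_def j_def)
  have "measure_pmf.expectation (random_ordering T k) (\<lambda>\<tau>. res (\<tau> t) (traj z \<tau> k))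
      = measure_pmf.expectation (random_ordering T t) (\<lambda>\<tau>. (avg ^^ j) (res (\<tau> t)) (traj z \<tau> t))"
    unfolding k using t by (intro expectation_past_task_traj) auto
  also have "\<dots> = measure_pmf.expectation (random_ordering T s)
      (\<lambda>\<tau>. (\<lambda>x. (\<Sum>m=1..T. (avg ^^ j) (res m) (step m x)) / real T) (traj z \<tau> s))"
    unfolding ts by (simp add: expectation_random_ordering_Suc[OF T_pos] traj_upd)
  also have "\<dots> = (avg ^^ s) (\<lambda>x. (\<Sum>m=1..T. (avg ^^ j) (res m) (step m x)) / real T) z"
    by (rule expectation_traj)
  also have "\<dots> \<le> 2 * (avg ^^ (s + j)) mean_res z + 2 * (avg ^^ s) mean_res z"
    by (rule avg_pow_revisit_le[OF z])
  finally show ?thesis using \<open>k - 1 = s + j\<close> by (simp add: s_def)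
qed

lemma expectation_forgetting_res_le:
  assumes z: "z \<in> carrier_vec d" and k: "1 \<le> k"
  shows "measure_pmf.expectation (random_ordering T k) (\<lambda>\<tau>. \<Sum>t=1..k. res (\<tau> t) (traj z \<tau> k))
       \<le> 2 * real k * (avg ^^ (k - 1)) mean_res z + 2 * (z \<bullet> z)"
proof -
  have "measure_pmf.expectation (random_ordering T k) (\<lambda>\<tau>. \<Sum>t=1..k. res (\<tau> t) (traj z \<tau> k))
      = (\<Sum>t=1..k. measure_pmf.expectation (random_ordering T k) (\<lambda>\<tau>. res (\<tau> t) (traj z \<tau> k)))"
    by (intro Bochner_Integration.integral_sum integrable_measure_pmf_finite
        finite_set_random_ordering T_pos)
  also have "\<dots> \<le> (\<Sum>t=1..k. 2 * (avg ^^ (k - 1)) mean_res z + 2 * (avg ^^ (t - 1)) mean_res z)"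
    by (intro sum_mono expectation_past_res_le z)
  also have "\<dots> = 2 * real k * (avg ^^ (k - 1)) mean_res z + 2 * (\<Sum>t=1..k. (avg ^^ (t - 1)) mean_res z)"
    by (simp add: sum.distrib sum_distrib_left)
  also have "(\<Sum>t=1..k. (avg ^^ (t - 1)) mean_res z) = (\<Sum>i<k. (avg ^^ i) mean_res z)"
    by (rule sum.reindex_bij_witness[of _ Suc "\<lambda>t. t - 1"]) auto
  also have "\<dots> \<le> z \<bullet> z" by (rule sum_avg_pow_mean_res_le[OF z])
  finally show ?thesis by simp
qed

end

section \<open>Transfer to continual linear regression\<close>

lemma random_projections_pseudo_inverse:
  assumes "1 \<le> T" "\<And>m. m \<in> {1..T} \<Longrightarrow> X m \<in> carrier_mat (n m) d"
  shows "random_projections d T (\<lambda>m. pseudo_inverse (X m) * X m)"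
proof
  fix m assume m: "m \<in> {1..T}"
  define A B where "A = X m" and "B = pseudo_inverse (X m)"
  have A: "A \<in> carrier_mat (n m) d" using assms(2)[OF m] by (simp add: A_def)
  have "is_pseudo_inverse A B"
    unfolding A_def B_def by (rule is_pseudo_inverse_pseudo_inverse)
  then have B: "B \<in> carrier_mat d (n m)" "B * A * B = B" "transpose_mat (B * A) = B * A"
    using A by (auto simp: is_pseudo_inverse_def)
  show "pseudo_inverse (X m) * X m \<in> carrier_mat d d"
    using A B unfolding A_def B_def by auto
  show "transpose_mat (pseudo_inverse (X m) * X m) = pseudo_inverse (X m) * X m"
    using B(3) unfolding A_def B_def .
  have "B * A \<in> carrier_mat d d" using A B by auto
  then have "B * A * (B * A) = B * A"
    using assoc_mult_mat[of "B * A" d d B "n m" A d] A B by simp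
  then show "pseudo_inverse (X m) * X m * (pseudo_inverse (X m) * X m) = pseudo_inverse (X m) * X m"
    unfolding A_def B_def .
qed (use assms in auto)

theorem theorem10:
  fixes d T k :: nat
    and n :: "nat \<Rightarrow> nat"
    and X :: "nat \<Rightarrow> real mat"
    and y :: "nat \<Rightarrow> real vec"
    and w_star :: "real vec"
    and R :: real
  assumes "T \<ge> 1"
    and "\<And>m. m \<in> {1..T} \<Longrightarrow> X m \<in> carrier_mat (n m) d"
    and "\<And>m. m \<in> {1..T} \<Longrightarrow> y m \<in> carrier_vec (n m)"
    and "joint_solutions d T X y \<noteq> {}"
    and "w_star = min_norm_solution d T X y"
    and "R = Max ((\<lambda>m. spectral_norm (X m)) ` {1..T})"
    and "k \<ge> 2"
  shows "measure_pmf.expectation (random_ordering T k)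
           (\<lambda>\<tau>. training_loss T X y (iterate d X y \<tau> k))
           \<le> 2 * (eucl_norm w_star)\<^sup>2 * R\<^sup>2 / root 4 (real k)
       \<and> measure_pmf.expectation (random_ordering T k)
           (\<lambda>\<tau>. forgetting d X y \<tau> k)
           \<le> 5 * (eucl_norm w_star)\<^sup>2 * R\<^sup>2 / root 4 (real k - 1)"
proof -
  note T = assms(1) and X = assms(2)
  have "w_star \<in> joint_solutions d T X y"
    unfolding assms(5) using min_norm_solution_in_joint_solutions[where n = n] X assms(4) by blast
  then have w: "w_star \<in> carrier_vec d" and Xw: "\<And>m. m \<in> {1..T} \<Longrightarrow> X m *\<^sub>v w_star = y m"
    by (auto simp: joint_solutions_def)
  interpret random_projections d T "\<lambda>m. pseudo_inverse (X m) * X m"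
    using random_projections_pseudo_inverse[where n = n] T X by blast
  \<comment> \<open>The error of the initial iterate, whose squared norm is that of
    \<open>w_star\<close> because learning starts at zero.\<close>
  define z where "z = 0\<^sub>v d - w_star"
  define E where "E = (eucl_norm w_star)\<^sup>2"
  have z: "z \<in> carrier_vec d" using w by (simp add: z_def)
  have zz: "z \<bullet> z = E"
    unfolding z_def E_def eucl_norm_square using w
    by (simp add: minus_scalar_prod_distrib[of _ d] scalar_prod_minus_distrib[of _ d])
  have E: "0 \<le> E" by (simp add: E_def)
  have residual: "X m *\<^sub>v v - y m = X m *\<^sub>v (v - w_star)"
    if "m \<in> {1..T}" "v \<in> carrier_vec d" for m v
    using mult_minus_distrib_mat_vec[OF X[OF that(1)] that(2) w] Xw[OF that(1)] by simp
  \<comment> \<open>By realizability the residual is X_m (v - w_star), so the update subtracts from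
    the error its image under X_m^+ X_m. The range condition on \<open>\<tau>\<close> supplies the
    matrix dimensions.\<close>
  have iterate_error: "iterate d X y \<tau> t \<in> carrier_vec d \<and> iterate d X y \<tau> t - w_star = traj z \<tau> t"
    if "\<And>s. s \<in> {1..t} \<Longrightarrow> \<tau> s \<in> {1..T}" for \<tau> t
    using that
  proof (induction t)
    case 0
    then show ?case using w by (simp add: z_def)
  next
    case (Suc t)
    define m v where "m = \<tau> (Suc t)" and "v = iterate d X y \<tau> t"
    have m: "m \<in> {1..T}" using Suc.prems[of "Suc t"] by (simp add: m_def)
    have v: "v \<in> carrier_vec d" "v - w_star = traj z \<tau> t" using Suc by (auto simp: v_def)
    have B: "pseudo_inverse (X m) \<in> carrier_mat d (n m)"
      using is_pseudo_inverse_pseudo_inverse[of "X m"] X[OF m] by (auto simp: is_pseudo_inverse_def)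
    have vw: "v - w_star \<in> carrier_vec d" using v(1) w by (rule minus_carrier_vec)
    have "pseudo_inverse (X m) *\<^sub>v (X m *\<^sub>v v - y m) = (pseudo_inverse (X m) * X m) *\<^sub>v (v - w_star)"
      unfolding residual[OF m v(1)] using assoc_mult_mat_vec[OF B X[OF m] vw] by simp
    then have "iterate d X y \<tau> (Suc t) = v - (pseudo_inverse (X m) * X m) *\<^sub>v (v - w_star)"
      by (simp add: m_def v_def Let_def)
    moreover have "(pseudo_inverse (X m) * X m) *\<^sub>v (v - w_star) \<in> carrier_vec d"
      using Q_mult_carrier[OF m vw] .
    moreover have "traj z \<tau> (Suc t) = v - w_star - (pseudo_inverse (X m) * X m) *\<^sub>v (v - w_star)"
      by (simp add: step_def m_def v(2))
    moreover have "v - q - w_star = v - w_star - q" if "q \<in> carrier_vec d" for q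
      using v(1) w that by (intro eq_vecI) auto
    ultimately show ?case using v(1) by (simp del: iterate.simps traj.simps)
  qed
  have R: "spectral_norm (X m) \<le> R" if "m \<in> {1..T}" for m
    unfolding assms(6) using that by (intro Max_ge) auto
  \<comment> \<open>Since X = X X^+ X, the residual depends only on the projected error
    \<open>q\<close>, so the spectral norm is paid on \<open>res\<close> rather than on the whole
    error.\<close>
  have loss: "(eucl_norm (X m *\<^sub>v iterate d X y \<tau> k - y m))\<^sup>2 \<le> R\<^sup>2 * res m (traj z \<tau> k)"
    if \<tau>: "\<tau> \<in> set_pmf (random_ordering T k)" and m: "m \<in> {1..T}" for \<tau> m
  proof -
    define u where "u = traj z \<tau> k"
    have u: "u \<in> carrier_vec d"
      unfolding u_def by (intro traj_carrier z random_ordering_range[OF T \<tau>])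
    have it: "iterate d X y \<tau> k \<in> carrier_vec d" "iterate d X y \<tau> k - w_star = u"
      using iterate_error[of k \<tau>] random_ordering_range[OF T \<tau>] by (auto simp: u_def)
    have "is_pseudo_inverse (X m) (pseudo_inverse (X m))" by (rule is_pseudo_inverse_pseudo_inverse)
    then have B: "pseudo_inverse (X m) \<in> carrier_mat d (n m)"
      "X m * pseudo_inverse (X m) * X m = X m"
      using X[OF m] by (auto simp: is_pseudo_inverse_def)
    define q where "q = (pseudo_inverse (X m) * X m) *\<^sub>v u"
    have q: "q \<in> carrier_vec d" unfolding q_def by (rule Q_mult_carrier[OF m u])
    have "X m *\<^sub>v q = (X m * (pseudo_inverse (X m) * X m)) *\<^sub>v u"
      unfolding q_def using assoc_mult_mat_vec[OF X[OF m] Q_carrier[OF m] u] by simp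
    also have "\<dots> = X m *\<^sub>v u" using assoc_mult_mat[OF X[OF m] B(1) X[OF m]] B(2) by simp
    finally have "X m *\<^sub>v iterate d X y \<tau> k - y m = X m *\<^sub>v q"
      using residual[OF m it(1)] it(2) by simp
    then have "(eucl_norm (X m *\<^sub>v iterate d X y \<tau> k - y m))\<^sup>2 \<le> (spectral_norm (X m))\<^sup>2 * (q \<bullet> q)"
      unfolding eucl_norm_square using mult_mat_vec_spectral_norm[of q "X m"] q X[OF m] by auto
    also have "\<dots> \<le> R\<^sup>2 * (q \<bullet> q)"
      by (intro mult_right_mono power_mono R m spectral_norm_nonneg scalar_prod_self_nonneg)
    finally show ?thesis by (simp add: res_def q_def u_def)
  qed
  define a where "a i = (avg ^^ i) mean_res z" for i
  \<comment> \<open>The free \<open>c\<close> serves both \<open>real k\<close> for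
    \<open>a k\<close> and \<open>real k - 1\<close> for \<open>a (k - 1)\<close>. The factor 2 of
    \<open>mean_res_decay\<close> is rounded up to 2^4 to leave the fourth root.\<close>
  have a_bound: "a i ^ 4 * c \<le> (2 * E) ^ 4" if "c \<le> real i + 2" for i c
  proof -
    have "a i ^ 4 * c \<le> a i ^ 4 * (real i + 2)" using that by (intro mult_left_mono) auto
    also have "\<dots> \<le> 2 * E ^ 4" using mean_res_decay[OF z, of i] by (simp add: a_def zz)
    also have "\<dots> \<le> (2 * E) ^ 4" by (simp add: power_mult_distrib)
    finally show ?thesis .
  qed
  have k: "1 \<le> real k - 1" using assms(7) by simp

  have "measure_pmf.expectation (random_ordering T k) (\<lambda>\<tau>. training_loss T X y (iterate d X y \<tau> k))
      \<le> measure_pmf.expectation (random_ordering T k) (\<lambda>\<tau>. R\<^sup>2 / 2 * mean_res (traj z \<tau> k))"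
  proof (rule expectation_random_ordering_mono[OF T])
    fix \<tau> assume \<tau>: "\<tau> \<in> set_pmf (random_ordering T k)"
    have "training_loss T X y (iterate d X y \<tau> k)
        \<le> 1 / (2 * real T) * (\<Sum>m=1..T. R\<^sup>2 * res m (traj z \<tau> k))"
      unfolding training_loss_def by (intro mult_left_mono sum_mono loss[OF \<tau>]) auto
    then show "training_loss T X y (iterate d X y \<tau> k) \<le> R\<^sup>2 / 2 * mean_res (traj z \<tau> k)"
      by (simp add: mean_res_def sum_distrib_left[symmetric])
  qed
  also have "\<dots> = R\<^sup>2 / 2 * a k"
    using expectation_traj[of k mean_res z] by (simp add: a_def)
  also have "\<dots> \<le> R\<^sup>2 / 2 * (2 * E / root 4 (real k))"
    using k E by (intro mult_left_mono le_divide_root4 a_bound) auto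
  also have "\<dots> = 1 * (E * R\<^sup>2 / root 4 (real k))" by simp
  also have "\<dots> \<le> 2 * (E * R\<^sup>2 / root 4 (real k))"
    using E by (intro mult_right_mono) auto
  finally have training: "measure_pmf.expectation (random_ordering T k)
      (\<lambda>\<tau>. training_loss T X y (iterate d X y \<tau> k)) \<le> 2 * E * R\<^sup>2 / root 4 (real k)"
    by simp

  have "measure_pmf.expectation (random_ordering T k) (\<lambda>\<tau>. forgetting d X y \<tau> k)
      \<le> measure_pmf.expectation (random_ordering T k)
          (\<lambda>\<tau>. R\<^sup>2 / (2 * real k) * (\<Sum>t=1..k. res (\<tau> t) (traj z \<tau> k)))"
  proof (rule expectation_random_ordering_mono[OF T])
    fix \<tau> assume \<tau>: "\<tau> \<in> set_pmf (random_ordering T k)"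
    have "forgetting d X y \<tau> k \<le> 1 / (2 * real k) * (\<Sum>t=1..k. R\<^sup>2 * res (\<tau> t) (traj z \<tau> k))"
      unfolding forgetting_def
      by (intro mult_left_mono sum_mono loss[OF \<tau>] random_ordering_range[OF T \<tau>]) auto
    then show "forgetting d X y \<tau> k \<le> R\<^sup>2 / (2 * real k) * (\<Sum>t=1..k. res (\<tau> t) (traj z \<tau> k))"
      by (simp add: sum_distrib_left[symmetric])
  qed
  also have "\<dots> = R\<^sup>2 / (2 * real k) * measure_pmf.expectation (random_ordering T k)
      (\<lambda>\<tau>. \<Sum>t=1..k. res (\<tau> t) (traj z \<tau> k))"
    by simp
  also have "\<dots> \<le> R\<^sup>2 / (2 * real k) * (2 * real k * a (k - 1) + 2 * E)"
    using expectation_forgetting_res_le[OF z, of k] assms(7)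
    by (intro mult_left_mono) (auto simp: a_def zz)
  \<comment> \<open>The normalization 1/(2k) keeps \<open>a (k - 1)\<close> at full size, while the
    telescoped residuals cost only \<open>E / real k\<close>.\<close>
  also have "\<dots> = R\<^sup>2 * (a (k - 1) + E / real k)"
    using k by (simp add: field_simps)
  also have "\<dots> \<le> R\<^sup>2 * (2 * E / root 4 (real k - 1) + E / root 4 (real k - 1))"
  proof (intro mult_left_mono add_mono)
    show "a (k - 1) \<le> 2 * E / root 4 (real k - 1)"
      using k E by (intro le_divide_root4 a_bound) auto
    \<comment> \<open>As \<open>real k - 1\<close> is at least 1, its fourth root is at most
      \<open>real k\<close>. Thus \<open>E / real k\<close> has the same form as the main term, for
      a total constant of 3.\<close>
    have "real k - 1 \<le> (real k - 1) ^ 4"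
      using k power_increasing[of 1 4 "real k - 1"] by simp
    then have "root 4 (real k - 1) \<le> root 4 ((real k - 1) ^ 4)" by simp
    also have "\<dots> = real k - 1" using k by (intro real_root_power_cancel) auto
    finally show "E / real k \<le> E / root 4 (real k - 1)"
      using k E by (intro divide_left_mono) auto
  qed auto
  also have "\<dots> = 3 * (E * R\<^sup>2 / root 4 (real k - 1))" by (simp add: algebra_simps)
  also have "\<dots> \<le> 5 * (E * R\<^sup>2 / root 4 (real k - 1))"
    using E k by (intro mult_right_mono) auto
  finally have "measure_pmf.expectation (random_ordering T k) (\<lambda>\<tau>. forgetting d X y \<tau> k)
      \<le> 5 * E * R\<^sup>2 / root 4 (real k - 1)"
    by simp
  with training show ?thesis unfolding E_def by blast
qed

end
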